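(* The solution of $$S^*=\mathrm{argmin}_{S\in\mathcal{D}(dp)}E[(S-l)^+]$$ is $S^*=S_{j^M,j^m}$, where $S_{j^M,j^m}$ is the random variable with pmf $s_{j^M,j^m}$.
   Context: Let $d\ge1$ be an integer and $p\in(0,1)$ rational. $\mathcal{D}(dp)$ is the class of (random variables with) discrete distributions on $\{0,1,\ldots,d\}$ with mean $dp$. $x^+=\max\{x,0\}$, and $l$ ranges over $\mathbb{R}_+$: the minimization is the search for the lower bound of $\mathcal{D}(dp)$ in the convex order, i.e. for $S^*\in\mathcal{D}(dp)$ with $E[(S^*-l)^+]\le E[(S-l)^+]$ for all $S\in\mathcal{D}(dp)$ and all $l\in\mathbb{R}_+$. $j^M$ is the largest integer less than $pd$ and $j^m$ is the smallest integer greater than $pd$. For integers $0\le j_1<pd<j_2\le d$, $s_{j_1,j_2}$ is the probability mass function (pmf) in $\mathcal{D}(dp)$ with support on the two points $j_1,j_2$, given by $s_{j_1,j_2}(j_1)=\frac{j_2-pd}{j_2-j_1}$, $s_{j_1,j_2}(j_2)=\frac{pd-j_1}{j_2-j_1}$, and $0$ otherwise.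
   Formalization: The formal theorem assumes in addition that pd is not an integer; if pd = k is an integer the claim fails, since the point mass at k lies in D(dp) and gives E[(S-k)^+] = 0, while S_{j^M,j^m} (on k-1 and k+1) gives 1/2. *)

theory Defs
  imports "HOL-Probability.Probability"
begin

text \<open>Only the law of \<open>S\<close> enters the problem, so a random variable on \<open>{0,\<dots>,d}\<close> is represented
  by its distribution, a \<open>nat pmf\<close>.\<close>

definition mean_class :: "nat \<Rightarrow> real \<Rightarrow> nat pmf set" where
  "mean_class d p =
     {S. set_pmf S \<subseteq> {0..d} \<and> measure_pmf.expectation S real = real d * p}"

definition stop_loss :: "nat pmf \<Rightarrow> real \<Rightarrow> real" where
  "stop_loss S l = measure_pmf.expectation S (\<lambda>k. max (real k - l) 0)"

text \<open>One \<open>S\<close> has to minimise \<open>E[(S - l)\<^sup>+]\<close> for all \<open>l \<ge> 0\<close> simultaneously, i.e. it is a lower bound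
  of the class in the convex order; the set below may a priori be empty.\<close>

definition argmin_stop_loss :: "nat \<Rightarrow> real \<Rightarrow> nat pmf set" where
  "argmin_stop_loss d p =
     {S \<in> mean_class d p. \<forall>S' \<in> mean_class d p. \<forall>l\<ge>0. stop_loss S l \<le> stop_loss S' l}"

text \<open>Natural numbers suffice for the two neighbouring integers, as \<open>p * d > 0\<close>.
  Both inequalities are strict: if \<open>p * d\<close> is itself an integer \<open>k\<close>, the neighbours are \<open>k - 1\<close> and
  \<open>k + 1\<close>. The pmf on these two points is then not a minimiser, since the point mass at \<open>k\<close> belongs to
  the class and has a smaller value at \<open>l = k\<close>.\<close>

definition jM :: "nat \<Rightarrow> real \<Rightarrow> nat" where
  "jM d p = (GREATEST j. real j < p * real d)"

definition jm :: "nat \<Rightarrow> real \<Rightarrow> nat" where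
  "jm d p = (LEAST j. p * real d < real j)"

definition two_point_mass :: "nat \<Rightarrow> real \<Rightarrow> nat \<Rightarrow> nat \<Rightarrow> nat \<Rightarrow> real" where
  "two_point_mass d p j1 j2 y =
     (if y = j1 then (real j2 - p * real d) / (real j2 - real j1)
      else if y = j2 then (p * real d - real j1) / (real j2 - real j1)
      else 0)"

text \<open>Meaningful only for \<open>j1 < p * d < j2\<close>, where \<open>two_point_mass\<close> is a probability mass function.\<close>

definition two_point_pmf :: "nat \<Rightarrow> real \<Rightarrow> nat \<Rightarrow> nat \<Rightarrow> nat pmf" where
  "two_point_pmf d p j1 j2 = embed_pmf (two_point_mass d p j1 j2)"

lemma pmf_two_point_pmf:
  assumes "real j1 < p * real d" "p * real d < real j2"
  shows "pmf (two_point_pmf d p j1 j2) y = two_point_mass d p j1 j2 y"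
  unfolding two_point_pmf_def
proof (rule pmf_embed_pmf)
  show nn: "0 \<le> two_point_mass d p j1 j2 x" for x
    using assms by (auto simp: two_point_mass_def)
  have ne: "j1 \<noteq> j2" and pos: "real j2 - real j1 > 0"
    using assms by auto
  have "(\<integral>\<^sup>+x. ennreal (two_point_mass d p j1 j2 x) \<partial>count_space UNIV)
      = (\<Sum>x\<in>{j1, j2}. ennreal (two_point_mass d p j1 j2 x))"
    by (rule nn_integral_count_space') (auto simp: two_point_mass_def)
  also have "\<dots> = ennreal (\<Sum>x\<in>{j1, j2}. two_point_mass d p j1 j2 x)"
    using nn by (intro sum_ennreal) auto
  also have "(\<Sum>x\<in>{j1, j2}. two_point_mass d p j1 j2 x) = 1"
    using ne pos by (simp add: two_point_mass_def add_divide_distrib[symmetric])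
  finally show "(\<integral>\<^sup>+x. ennreal (two_point_mass d p j1 j2 x) \<partial>count_space UNIV) = 1"
    by simp
qed

end

theory Submission
  imports Defs
begin

text \<open>Let \<open>j\<close> be the integer part of \<open>p d\<close>. A convex function lies, at every integer, above its chord
  through \<open>j\<close> and \<open>j + 1\<close>, and the mean of the chord is the same for all laws of mean \<open>p d\<close>; the
  two-point law attains it. Conversely, comparing with the two-point law at \<open>l = j + 1\<close> and \<open>l = j\<close>
  confines a minimiser to \<open>{j, j + 1}\<close>, where its mean determines it.\<close>

text \<open>If the kink \<open>l\<close> is not strictly between \<open>j\<close> and
  \<open>j + 1\<close>, the chord is one of the two linear pieces \<open>0\<close> and
  \<open>k - l\<close>, and each is at most their maximum. Otherwise the chord vanishes at
  \<open>j\<close> and has slope \<open>j + 1 - l\<close>.\<close>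

lemma stop_loss_above_chord:
  fixes j k :: nat and l :: real
  shows "max (real j - l) 0 + (max (real (Suc j) - l) 0 - max (real j - l) 0) * (real k - real j)
    \<le> max (real k - l) 0"
proof -
  consider "l \<le> real j" | "real (Suc j) \<le> l" | "real j < l" "l < real (Suc j)"
    by linarith
  then show ?thesis
  proof cases
    case 3
    show ?thesis
    proof (cases "k \<le> j")
      case True
      then have "(real (Suc j) - l) * (real k - real j) \<le> 0"
        using 3 by (intro mult_nonneg_nonpos) auto
      then show ?thesis
        using 3 by simp
    next
      case False
      \<comment> \<open>Integrality of \<open>k\<close> gives \<open>k \<ge> j + 1\<close>; the
        product is exactly \<open>k - l\<close> minus the chord at \<open>k\<close>.\<close>
      then have "0 \<le> (l - real j) * (real k - real (Suc j))"
        using 3 by (intro mult_nonneg_nonneg) auto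
      then show ?thesis
        using 3 by (simp add: algebra_simps)
    qed
  qed auto
qed

text \<open>Serves to turn a vanishing expected value into a restriction on the support.\<close>

lemma expectation_pmf_eq_0_D:
  fixes f :: "'a \<Rightarrow> real"
  assumes "finite (set_pmf S)" "\<And>x. 0 \<le> f x" "measure_pmf.expectation S f = 0" "x \<in> set_pmf S"
  shows "f x = 0"
proof -
  have "AE x in measure_pmf S. f x = 0"
    using assms integral_nonneg_eq_0_iff_AE[of "measure_pmf S" f]
    by (simp add: integrable_measure_pmf_finite)
  then show ?thesis
    using assms(4) by (simp add: AE_measure_pmf_iff)
qed

lemma expectation_affine_pmf:
  assumes "finite (set_pmf S)"
  shows "measure_pmf.expectation S (\<lambda>k. a + c * (real k - b))
    = a + c * (measure_pmf.expectation S real - b)"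
  using integrable_measure_pmf_finite[OF assms, of real] by simp

lemma finite_set_pmf_mean_class: "S \<in> mean_class d p \<Longrightarrow> finite (set_pmf S)"
  by (auto simp: mean_class_def intro: finite_subset)

lemma set_two_point_pmf:
  assumes "real j1 < p * real d" "p * real d < real j2"
  shows "set_pmf (two_point_pmf d p j1 j2) = {j1, j2}"
  using assms by (auto simp: set_pmf_eq pmf_two_point_pmf two_point_mass_def)

lemma expectation_two_point_pmf:
  assumes "real j1 < p * real d" "p * real d < real j2"
  shows "measure_pmf.expectation (two_point_pmf d p j1 j2) f
    = f j1 * ((real j2 - p * real d) / (real j2 - real j1))
      + f j2 * ((p * real d - real j1) / (real j2 - real j1))"
proof -
  have "j1 \<noteq> j2"
    using assms by auto
  then show ?thesis
    using integral_measure_pmf_real[of "{j1, j2}" "two_point_pmf d p j1 j2" f] assms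
    by (simp add: set_two_point_pmf pmf_two_point_pmf two_point_mass_def)
qed

lemma two_point_pmf_in_mean_class:
  assumes "real j1 < p * real d" "p * real d < real j2" "j2 \<le> d"
  shows "two_point_pmf d p j1 j2 \<in> mean_class d p"
proof -
  have "j1 \<le> j2" "real j2 - real j1 \<noteq> 0"
    using assms by linarith+
  then show ?thesis
    using assms
    by (simp add: mean_class_def set_two_point_pmf expectation_two_point_pmf
        add_divide_distrib[symmetric]) (simp add: field_simps)
qed

text \<open>The atoms are one apart, so their weights are \<open>j + 1 - p d\<close> and
  \<open>p d - j\<close>: averaging the payoff over them evaluates the chord at the mean.\<close>

lemma stop_loss_two_point_Suc:
  assumes "real j < p * real d" "p * real d < real (Suc j)"
  shows "stop_loss (two_point_pmf d p j (Suc j)) l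
    = max (real j - l) 0
      + (max (real (Suc j) - l) 0 - max (real j - l) 0) * (p * real d - real j)"
  unfolding stop_loss_def expectation_two_point_pmf[OF assms]
  by (simp add: left_diff_distrib right_diff_distrib distrib_left distrib_right)

lemma stop_loss_two_point_Suc_le:
  assumes "real j < p * real d" "p * real d < real (Suc j)" "S \<in> mean_class d p"
  shows "stop_loss (two_point_pmf d p j (Suc j)) l \<le> stop_loss S l"
proof -
  note fin = finite_set_pmf_mean_class[OF assms(3)]
  let ?c = "max (real (Suc j) - l) 0 - max (real j - l) 0"
  \<comment> \<open>The chord is affine, so its expectation under \<open>S\<close> is its value at
    the mean \<open>p d\<close>.\<close>
  have "stop_loss (two_point_pmf d p j (Suc j)) l
      = measure_pmf.expectation S (\<lambda>k. max (real j - l) 0 + ?c * (real k - real j))"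
    using assms(3) unfolding stop_loss_two_point_Suc[OF assms(1,2)] expectation_affine_pmf[OF fin]
    by (simp add: mean_class_def mult.commute)
  also have "\<dots> \<le> stop_loss S l"
    unfolding stop_loss_def
    by (intro integral_mono integrable_measure_pmf_finite fin stop_loss_above_chord)
  finally show ?thesis .
qed

text \<open>Total mass and mean are two linear equations for the two masses, with determinant
  \<open>j2 - j1 \<noteq> 0\<close>.\<close>

lemma mean_class_two_point_unique:
  assumes "real j1 < p * real d" "p * real d < real j2"
    and "S \<in> mean_class d p" "set_pmf S \<subseteq> {j1, j2}"
  shows "S = two_point_pmf d p j1 j2"
proof (rule pmf_eqI)
  fix y
  have ne: "j1 \<noteq> j2" "real j2 - real j1 \<noteq> 0"
    using assms by auto
  have total: "pmf S j1 + pmf S j2 = 1"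
    using sum_pmf_eq_1[of "{j1, j2}" S] assms(4) ne by simp
  have mean: "real j1 * pmf S j1 + real j2 * pmf S j2 = p * real d"
  proof -
    have "measure_pmf.expectation S real = (\<Sum>k\<in>{j1, j2}. real k * pmf S k)"
      by (rule integral_measure_pmf_real) (use assms(4) in auto)
    then show ?thesis
      using assms(3) ne by (simp add: mean_class_def mult.commute)
  qed
  have "pmf S j1 = 1 - pmf S j2"
    using total by simp
  with mean have "pmf S j2 * (real j2 - real j1) = p * real d - real j1"
    by (simp add: algebra_simps)
  then have b: "pmf S j2 = (p * real d - real j1) / (real j2 - real j1)"
    using ne by (simp add: nonzero_eq_divide_eq)
  have a: "pmf S j1 = (real j2 - p * real d) / (real j2 - real j1)"
    using total b ne by (simp add: field_simps)
  show "pmf S y = pmf (two_point_pmf d p j1 j2) y"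
    using a b assms(4)
    by (auto simp: pmf_two_point_pmf[OF assms(1,2)] two_point_mass_def set_pmf_eq)
qed

lemma set_pmf_argmin_stop_loss:
  assumes "real j < p * real d" "p * real d < real (Suc j)" "Suc j \<le> d"
    and S: "S \<in> argmin_stop_loss d p"
  shows "set_pmf S \<subseteq> {j, Suc j}"
proof
  fix x assume x: "x \<in> set_pmf S"
  have mem: "S \<in> mean_class d p"
    using S by (simp add: argmin_stop_loss_def)
  note fin = finite_set_pmf_mean_class[OF mem]
  have le: "stop_loss S l \<le> stop_loss (two_point_pmf d p j (Suc j)) l" if "0 \<le> l" for l
    using S two_point_pmf_in_mean_class[OF assms(1-3)] that by (simp add: argmin_stop_loss_def)
  have eq: "stop_loss S l = stop_loss (two_point_pmf d p j (Suc j)) l" if "0 \<le> l" for l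
    using le[OF that] stop_loss_two_point_Suc_le[OF assms(1,2) mem, of l] by simp
  \<comment> \<open>At \<open>l = j + 1\<close> neither atom of the two-point law pays anything, so
    the minimiser has no mass above \<open>j + 1\<close>.\<close>
  have "stop_loss S (real (Suc j)) = 0"
    unfolding eq[OF of_nat_0_le_iff] stop_loss_two_point_Suc[OF assms(1,2)] by simp
  then have "max (real x - real (Suc j)) 0 = 0"
    using expectation_pmf_eq_0_D[OF fin _ _ x, of "\<lambda>k. max (real k - real (Suc j)) 0"]
    by (simp add: stop_loss_def)
  then have upper: "x \<le> Suc j"
    by (simp add: max_def split: if_splits)
  \<comment> \<open>At \<open>l = j\<close> the minimal value equals the mean of
    \<open>k - j\<close>. The difference of the two integrands is the nonnegative function
    \<open>(j - k)^+\<close>, so there is no mass below \<open>j\<close>.\<close>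
  have "stop_loss S (real j) = p * real d - real j"
    unfolding eq[OF of_nat_0_le_iff] stop_loss_two_point_Suc[OF assms(1,2)] by simp
  moreover have "measure_pmf.expectation S (\<lambda>k. real k - real j) = p * real d - real j"
    using expectation_affine_pmf[OF fin, of 0 1 "real j"] mem
    by (simp add: mean_class_def mult.commute)
  ultimately have "measure_pmf.expectation S (\<lambda>k. max (real k - real j) 0 - (real k - real j)) = 0"
    by (subst Bochner_Integration.integral_diff)
      (simp_all only: integrable_measure_pmf_finite[OF fin] stop_loss_def diff_self)
  then have "max (real x - real j) 0 - (real x - real j) = 0"
    using expectation_pmf_eq_0_D[OF fin _ _ x,
        of "\<lambda>k. max (real k - real j) 0 - (real k - real j)"] by simp
  then have "j \<le> x"
    by (simp add: max_def split: if_splits)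
  with upper show "x \<in> {j, Suc j}"
    by auto
qed

lemma argmin_stop_loss_eq:
  assumes "real j < p * real d" "p * real d < real (Suc j)" "Suc j \<le> d"
  shows "argmin_stop_loss d p = {two_point_pmf d p j (Suc j)}"
proof (intro equalityI subsetI)
  fix S assume S: "S \<in> argmin_stop_loss d p"
  then have "S \<in> mean_class d p"
    by (simp add: argmin_stop_loss_def)
  then show "S \<in> {two_point_pmf d p j (Suc j)}"
    using mean_class_two_point_unique[OF assms(1,2)] set_pmf_argmin_stop_loss[OF assms S] by simp
next
  fix S assume "S \<in> {two_point_pmf d p j (Suc j)}"
  then show "S \<in> argmin_stop_loss d p"
    using two_point_pmf_in_mean_class[OF assms] stop_loss_two_point_Suc_le[OF assms(1,2)]
    by (simp add: argmin_stop_loss_def)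
qed

lemma jM_eq:
  assumes "real j < p * real d" "p * real d < real (Suc j)"
  shows "jM d p = j"
  unfolding jM_def by (rule Greatest_equality) (use assms in auto)

lemma jm_eq:
  assumes "real j < p * real d" "p * real d < real (Suc j)"
  shows "jm d p = Suc j"
  unfolding jm_def by (rule Least_equality) (use assms in auto)

text \<open>Non-integrality of \<open>p * real d\<close> makes \<open>jM d p\<close> and
  \<open>jm d p\<close> consecutive, as the chord argument requires. The singleton expresses
  existence together with uniqueness in law.\<close>

theorem proposition5p2:
  fixes d :: nat and p :: real
  assumes "d \<ge> 1" and "p \<in> \<rat>" and "0 < p" and "p < 1"
    and "p * real d \<notin> \<int>"
  shows "argmin_stop_loss d p = {two_point_pmf d p (jM d p) (jm d p)}"
proof -
  define j where "j = nat \<lfloor>p * real d\<rfloor>"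
  have "0 \<le> p * real d"
    using assms by simp
  then have j: "real j = of_int \<lfloor>p * real d\<rfloor>"
    by (simp add: j_def)
  have "real j \<noteq> p * real d"
    using assms(5) by (metis Ints_of_nat)
  then have lower: "real j < p * real d"
    using j of_int_floor_le[of "p * real d"] by linarith
  have upper: "p * real d < real (Suc j)"
    using j floor_correct[of "p * real d"] by linarith
  \<comment> \<open>This keeps the upper atom \<open>j + 1\<close> inside \<open>{0..d}\<close>, so
    that the two-point law belongs to the class.\<close>
  have "p * real d < real d"
    using assms by simp
  with lower have "Suc j \<le> d"
    by linarith
  then show ?thesis
    using argmin_stop_loss_eq[OF lower upper] jM_eq[OF lower upper] jm_eq[OF lower upper] by simp
qed

end
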